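(* Let $\langle P,T,\mathbf{Pre},\mathbf{Post}\rangle$ be a state-machine Petri net with incidence matrix $\mathbf{C}=\mathbf{Post}-\mathbf{Pre}$, let $\mathbf{m}_0,\mathbf{m}_f\in\mathbb{N}_{\ge0}^{|P|}$ be given initial and final markings, and let $\bar{s}\ge 1$ be a fixed integer. Consider the following multi-stage problem in the variables $\mathbf{m}_1,\dots,\mathbf{m}_{\bar s}\in\mathbb{R}^{|P|}$ and $\boldsymbol{\sigma}_1,\dots,\boldsymbol{\sigma}_{\bar s}\in\mathbb{R}^{|T|}$: $$\begin{aligned}\text{minimize}\quad & \sum_{i=1}^{\bar s}\mathbf{1}^\top\boldsymbol{\sigma}_i\,\bigl(1+(\bar s-i)\bigr)\\ \text{subject to}\quad & \mathbf{m}_i=\mathbf{m}_{i-1}+\mathbf{C}\,\boldsymbol{\sigma}_i,\quad i=1,\dots,\bar s,\\ & \mathbf{Post}\,\boldsymbol{\sigma}_i+\mathbf{m}_{i-1}\le\mathbf{1},\quad i=1,\dots,\bar s,\\ & \mathbf{m}_{\bar s}=\mathbf{m}_f,\\ & \mathbf{m}_i\ge\mathbf{0},\ \boldsymbol{\sigma}_i\ge\mathbf{0},\quad i=1,\dots,\bar s.\end{aligned}$$ Then the constraint matrix of this problem (the coefficient matrix of its linear equality and inequality constraints with respect to the variables $\mathbf{m}_1,\dots,\mathbf{m}_{\bar s},\boldsymbol{\sigma}_1,\dots,\boldsymbol{\sigma}_{\bar s}$, the given vector $\mathbf{m}_0$ being moved to the right-hand side) is totally unimodular.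
   Context: A Petri net here consists of a finite set $P$ of places, a finite set $T$ of transitions, and matrices $\mathbf{Pre},\mathbf{Post}\in\{0,1\}^{|P|\times|T|}$. It is a state machine if every transition $t$ has exactly one input place and exactly one output place, i.e. each column of $\mathbf{Pre}$ and each column of $\mathbf{Post}$ has exactly one entry equal to $1$ (all others $0$). The incidence matrix is $\mathbf{C}=\mathbf{Post}-\mathbf{Pre}$. Markings $\mathbf{m}_i$ give the number of robots (tokens) in each place after stage $i$, and $\boldsymbol{\sigma}_i$ is the firing-count vector of stage $i$; $\bar s$ is the number of synchronization stages. A matrix is totally unimodular if each of its square submatrices has determinant in $\{-1,0,1\}$. Inequalities between vectors are entrywise, and $\mathbf{1}$ is the all-ones vector. *)

theory Defs
  imports "Jordan_Normal_Form.Determinant" "Jordan_Normal_Form.DL_Submatrix"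
begin

definition totally_unimodular :: "'a :: comm_ring_1 mat \<Rightarrow> bool" where
  "totally_unimodular A \<longleftrightarrow>
     (\<forall>I J. square_mat (submatrix A I J) \<longrightarrow> det (submatrix A I J) \<in> {- 1, 0, 1})"

text \<open>Places are \<open>0, \<dots>, np - 1\<close> and transitions are \<open>0, \<dots>, nt - 1\<close>.
  Rows of the matrices are indexed by places and columns by transitions.\<close>

definition petri_net :: "nat \<Rightarrow> nat \<Rightarrow> real mat \<Rightarrow> real mat \<Rightarrow> bool" where
  "petri_net np nt Pre Post \<longleftrightarrow>
     Pre \<in> carrier_mat np nt \<and> Post \<in> carrier_mat np nt \<and>
     elements_mat Pre \<subseteq> {0, 1} \<and> elements_mat Post \<subseteq> {0, 1}"

definition state_machine :: "nat \<Rightarrow> nat \<Rightarrow> real mat \<Rightarrow> real mat \<Rightarrow> bool" where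
  "state_machine np nt Pre Post \<longleftrightarrow> petri_net np nt Pre Post \<and>
     (\<forall>t<nt. (\<exists>!p. p < np \<and> Pre $$ (p, t) = 1) \<and> (\<exists>!p. p < np \<and> Post $$ (p, t) = 1))"

definition incidence :: "real mat \<Rightarrow> real mat \<Rightarrow> real mat" where
  "incidence Pre Post = Post - Pre"

definition ones :: "nat \<Rightarrow> real vec" where
  "ones n = vec n (\<lambda>_. 1)"

text \<open>\<open>m i\<close> is the marking after stage \<open>i\<close> and \<open>\<sigma> i\<close> the firing-count vector of stage \<open>i\<close>.
  The value \<open>m 0\<close> is not a variable: it is fixed to the given initial marking \<open>m0\<close>.\<close>

definition msp_feasible ::
    "real mat \<Rightarrow> real mat \<Rightarrow> nat vec \<Rightarrow> nat vec \<Rightarrow> nat \<Rightarrow> (nat \<Rightarrow> real vec) \<Rightarrow> (nat \<Rightarrow> real vec) \<Rightarrow> bool"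
  where
  "msp_feasible Pre Post m0 mf s m \<sigma> \<longleftrightarrow>
     m 0 = map_vec real m0 \<and>
     (\<forall>i\<in>{1..s}. m i = m (i - 1) + incidence Pre Post *\<^sub>v \<sigma> i) \<and>
     (\<forall>i\<in>{1..s}. Post *\<^sub>v \<sigma> i + m (i - 1) \<le> ones (dim_row Post)) \<and>
     m s = map_vec real mf \<and>
     (\<forall>i\<in>{1..s}. 0\<^sub>v (dim_row Pre) \<le> m i \<and> 0\<^sub>v (dim_col Pre) \<le> \<sigma> i)"

definition msp_objective :: "real mat \<Rightarrow> nat \<Rightarrow> (nat \<Rightarrow> real vec) \<Rightarrow> real" where
  "msp_objective Pre s \<sigma> = (\<Sum>i=1..s. (ones (dim_col Pre) \<bullet> \<sigma> i) * (1 + (real s - real i)))"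

datatype relation = Eq | Le | Ge

fun holds :: "relation \<Rightarrow> real \<Rightarrow> real \<Rightarrow> bool" where
  "holds Eq a b \<longleftrightarrow> a = b"
| "holds Le a b \<longleftrightarrow> a \<le> b"
| "holds Ge a b \<longleftrightarrow> a \<ge> b"

record linear_program =
  cost_vector :: "real vec"
  constraint_matrix :: "real mat"
  constraint_rel :: "nat \<Rightarrow> relation"
  constraint_rhs :: "real vec"

definition lp_feasible :: "linear_program \<Rightarrow> real vec \<Rightarrow> bool" where
  "lp_feasible L x \<longleftrightarrow> x \<in> carrier_vec (dim_col (constraint_matrix L)) \<and>
     (\<forall>r < dim_row (constraint_matrix L).
        holds (constraint_rel L r) ((constraint_matrix L *\<^sub>v x) $ r) (constraint_rhs L $ r))"

text \<open>Symbolic names for the columns (\<open>MVar i p\<close> is the entry \<open>p\<close> of \<open>m i\<close>, \<open>SVar i t\<close> the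
  entry \<open>t\<close> of \<open>\<sigma> i\<close>) and for the rows, one per scalar constraint.\<close>

datatype variable = MVar nat nat | SVar nat nat

datatype constr = Flow nat nat | Capacity nat nat | Final nat | MNonneg nat nat | SNonneg nat nat

definition msp_variables :: "nat \<Rightarrow> nat \<Rightarrow> nat \<Rightarrow> variable list" where
  "msp_variables np nt s =
     [MVar i p. i \<leftarrow> [1..<Suc s], p \<leftarrow> [0..<np]] @ [SVar i t. i \<leftarrow> [1..<Suc s], t \<leftarrow> [0..<nt]]"

definition msp_rows :: "nat \<Rightarrow> nat \<Rightarrow> nat \<Rightarrow> constr list" where
  "msp_rows np nt s =
     [Flow i p. i \<leftarrow> [1..<Suc s], p \<leftarrow> [0..<np]] @
     [Capacity i p. i \<leftarrow> [1..<Suc s], p \<leftarrow> [0..<np]] @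
     [Final p. p \<leftarrow> [0..<np]] @
     [MNonneg i p. i \<leftarrow> [1..<Suc s], p \<leftarrow> [0..<np]] @
     [SNonneg i t. i \<leftarrow> [1..<Suc s], t \<leftarrow> [0..<nt]]"

text \<open>With all variables moved to the left, row \<open>Flow i p\<close> reads
  \<open>m i $ p - m (i - 1) $ p - (C *\<^sub>v \<sigma> i) $ p = 0\<close>. For \<open>i = 1\<close> the entry of \<open>m 0\<close> is data, not a
  variable, so it goes to the right-hand side; no \<open>MVar 0 p\<close> occurs in \<open>msp_variables\<close>.\<close>

fun coeff_of :: "real mat \<Rightarrow> real mat \<Rightarrow> nat \<Rightarrow> constr \<Rightarrow> variable \<Rightarrow> real" where
  "coeff_of Pre Post s (Flow i p) (MVar j q) =
     (if q \<noteq> p then 0 else if j = i then 1 else if Suc j = i then - 1 else 0)"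
| "coeff_of Pre Post s (Flow i p) (SVar j t) = (if j = i then - (incidence Pre Post $$ (p, t)) else 0)"
| "coeff_of Pre Post s (Capacity i p) (MVar j q) = (if q = p \<and> Suc j = i then 1 else 0)"
| "coeff_of Pre Post s (Capacity i p) (SVar j t) = (if j = i then Post $$ (p, t) else 0)"
| "coeff_of Pre Post s (Final p) (MVar j q) = (if q = p \<and> j = s then 1 else 0)"
| "coeff_of Pre Post s (Final p) (SVar j t) = 0"
| "coeff_of Pre Post s (MNonneg i p) (MVar j q) = (if q = p \<and> j = i then 1 else 0)"
| "coeff_of Pre Post s (MNonneg i p) (SVar j t) = 0"
| "coeff_of Pre Post s (SNonneg i t) (MVar j q) = 0"
| "coeff_of Pre Post s (SNonneg i t) (SVar j u) = (if u = t \<and> j = i then 1 else 0)"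

fun rel_of :: "constr \<Rightarrow> relation" where
  "rel_of (Flow i p) = Eq"
| "rel_of (Capacity i p) = Le"
| "rel_of (Final p) = Eq"
| "rel_of (MNonneg i p) = Ge"
| "rel_of (SNonneg i t) = Ge"

fun rhs_of :: "nat vec \<Rightarrow> nat vec \<Rightarrow> constr \<Rightarrow> real" where
  "rhs_of m0 mf (Flow i p) = (if i = 1 then real (m0 $ p) else 0)"
| "rhs_of m0 mf (Capacity i p) = 1 - (if i = 1 then real (m0 $ p) else 0)"
| "rhs_of m0 mf (Final p) = real (mf $ p)"
| "rhs_of m0 mf (MNonneg i p) = 0"
| "rhs_of m0 mf (SNonneg i t) = 0"

fun cost_of :: "nat \<Rightarrow> variable \<Rightarrow> real" where
  "cost_of s (MVar i p) = 0"
| "cost_of s (SVar i t) = 1 + (real s - real i)"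

definition msp_lp :: "real mat \<Rightarrow> real mat \<Rightarrow> nat vec \<Rightarrow> nat vec \<Rightarrow> nat \<Rightarrow> linear_program" where
  "msp_lp Pre Post m0 mf s =
     (let vs = msp_variables (dim_row Pre) (dim_col Pre) s; rs = msp_rows (dim_row Pre) (dim_col Pre) s in
      \<lparr> cost_vector = vec_of_list (map (cost_of s) vs),
        constraint_matrix =
          mat (length rs) (length vs) (\<lambda>(r, c). coeff_of Pre Post s (rs ! r) (vs ! c)),
        constraint_rel = (\<lambda>r. rel_of (rs ! r)),
        constraint_rhs = vec_of_list (map (rhs_of m0 mf) rs) \<rparr>)"

fun value_of :: "(nat \<Rightarrow> real vec) \<Rightarrow> (nat \<Rightarrow> real vec) \<Rightarrow> variable \<Rightarrow> real" where
  "value_of m \<sigma> (MVar i p) = m i $ p"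
| "value_of m \<sigma> (SVar i t) = \<sigma> i $ t"

definition stack :: "nat \<Rightarrow> nat \<Rightarrow> nat \<Rightarrow> (nat \<Rightarrow> real vec) \<Rightarrow> (nat \<Rightarrow> real vec) \<Rightarrow> real vec" where
  "stack np nt s m \<sigma> = vec_of_list (map (value_of m \<sigma>) (msp_variables np nt s))"

lemma sum_list_upt_concat:
  "sum_list (map f (concat (map (\<lambda>i. map (g i) [0..<n]) [a..<Suc b]))) =
     (\<Sum>i=a..b. \<Sum>j<n. (f (g i j) :: real))"
proof -
  have 1: "sum_list (map f (concat (map (\<lambda>i. map (g i) [0..<n]) xs))) =
     sum_list (map (\<lambda>i. \<Sum>j<n. f (g i j)) xs)" for xs
    by (induction xs) (auto simp: comp_def interv_sum_list_conv_sum_set_nat atLeast0LessThan)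
  show ?thesis
    unfolding 1 interv_sum_list_conv_sum_set_nat
    by (simp only: set_upt atLeastLessThanSuc_atLeastAtMost)
qed

lemma sum_list_variables:
  "sum_list (map f (msp_variables np nt s)) =
     (\<Sum>i=1..s. \<Sum>p<np. (f (MVar i p) :: real)) + (\<Sum>i=1..s. \<Sum>t<nt. f (SVar i t))"
  unfolding msp_variables_def map_append sum_list_append sum_list_upt_concat ..

lemma scalar_prod_lists:
  "vec_of_list (map f xs) \<bullet> vec_of_list (map g xs) = sum_list (map (\<lambda>x. f x * (g x :: real)) xs)"
  by (simp add: scalar_prod_def sum_list_sum_nth vec_of_list_index)

lemma ball_upt_concat:
  "(\<forall>r\<in>set (concat (map (\<lambda>i. map (g i) [0..<n]) [a..<Suc b])). Q r) \<longleftrightarrow>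
    (\<forall>i\<in>{a..b}. \<forall>j<n. Q (g i j))"
  by (simp only: set_concat set_map set_upt atLeastLessThanSuc_atLeastAtMost) auto

lemma ball_msp_rows:
  "(\<forall>r\<in>set (msp_rows np nt s). Q r) \<longleftrightarrow>
    (\<forall>i\<in>{1..s}. \<forall>p<np. Q (Flow i p)) \<and> (\<forall>i\<in>{1..s}. \<forall>p<np. Q (Capacity i p)) \<and>
    (\<forall>p<np. Q (Final p)) \<and>
    (\<forall>i\<in>{1..s}. (\<forall>p<np. Q (MNonneg i p)) \<and> (\<forall>t<nt. Q (SNonneg i t)))"
proof -
  have "(\<forall>r\<in>set (map Final [0..<np]). Q r) \<longleftrightarrow> (\<forall>p<np. Q (Final p))" by auto
  then show ?thesis
    unfolding msp_rows_def set_append ball_Un ball_upt_concat ball_conj_distrib by argo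
qed

lemma msp_lp_feasible_iff:
  assumes "dim_row Pre = np" "dim_col Pre = nt"
  shows "lp_feasible (msp_lp Pre Post m0 mf s) (stack np nt s m \<sigma>) \<longleftrightarrow>
    (\<forall>r\<in>set (msp_rows np nt s). holds (rel_of r)
       ((\<Sum>i=1..s. \<Sum>p<np. coeff_of Pre Post s r (MVar i p) * m i $ p) +
        (\<Sum>i=1..s. \<Sum>t<nt. coeff_of Pre Post s r (SVar i t) * \<sigma> i $ t)) (rhs_of m0 mf r))"
proof -
  define vs where "vs = msp_variables np nt s"
  define rs where "rs = msp_rows np nt s"
  have row: "(mat (length rs) (length vs) (\<lambda>(r, c). coeff_of Pre Post s (rs ! r) (vs ! c)) *\<^sub>v
      stack np nt s m \<sigma>) $ r =
       (\<Sum>i=1..s. \<Sum>p<np. coeff_of Pre Post s (rs ! r) (MVar i p) * m i $ p) +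
        (\<Sum>i=1..s. \<Sum>t<nt. coeff_of Pre Post s (rs ! r) (SVar i t) * \<sigma> i $ t)"
    if "r < length rs" for r
  proof -
    have "Matrix.row (mat (length rs) (length vs) (\<lambda>(r, c). coeff_of Pre Post s (rs ! r) (vs ! c))) r
        = vec_of_list (map (coeff_of Pre Post s (rs ! r)) vs)"
      using that by (intro eq_vecI) (auto simp: vec_of_list_index)
    then show ?thesis using that
      by (simp add: stack_def scalar_prod_lists del: vec_of_list_map flip: vs_def)
        (simp add: vs_def sum_list_variables)
  qed
  have "stack np nt s m \<sigma> \<in> carrier_vec (length vs)"
    by (intro carrier_vecI) (simp add: stack_def vs_def)
  moreover have "vec_of_list (map (rhs_of m0 mf) rs) $ r = rhs_of m0 mf (rs ! r)"
    if "r < length rs" for r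
    using that by (simp add: vec_of_list_index del: vec_of_list_map)
  ultimately show ?thesis
    unfolding lp_feasible_def msp_lp_def Let_def assms vs_def[symmetric] rs_def[symmetric]
      all_set_conv_all_nth linear_program.simps dim_row_mat dim_col_mat
    by (simp only: row rs_def[symmetric] simp_thms cong: conj_cong imp_cong)
qed

lemma sum_delta_pair:
  assumes "i \<in> {1..s::nat}" "p < (np::nat)"
  shows "(\<Sum>j=1..s. \<Sum>q<np. (if q = p \<and> j = i then 1 else 0) * f j q) = (f i p :: real)"
proof -
  have "(\<Sum>j=1..s. \<Sum>q<np. (if q = p \<and> j = i then 1 else 0) * f j q) =
    (\<Sum>j=1..s. if j = i then f j p else 0)"
    using assms by (intro sum.cong refl) (auto simp: if_distrib[of "\<lambda>x. x * _"] sum.delta cong: if_cong)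
  then show ?thesis using assms by simp
qed

lemma sum_delta_stage:
  assumes "i \<in> {1..s::nat}"
  shows "(\<Sum>j=1..s. \<Sum>t<nt. (if j = i then c t else 0) * f j t) = (\<Sum>t<(nt::nat). c t * (f i t :: real))"
proof -
  have "(\<Sum>j=1..s. \<Sum>t<nt. (if j = i then c t else 0) * f j t) =
    (\<Sum>j=1..s. if j = i then (\<Sum>t<nt. c t * f j t) else 0)"
    by (intro sum.cong refl) auto
  then show ?thesis using assms by simp
qed

lemma sum_delta_prev:
  assumes "i \<in> {1..s::nat}" "p < (np::nat)"
  shows "(\<Sum>j=1..s. \<Sum>q<np. (if q = p \<and> Suc j = i then 1 else 0) * f j q) =
    (if i = 1 then 0 else f (i - 1) p :: real)"
proof (cases "i = 1")
  case True
  then show ?thesis by (auto intro!: sum.neutral)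
next
  case False
  then have "Suc j = i \<longleftrightarrow> j = i - 1" for j using assms by auto
  moreover have "i - 1 \<in> {1..s}" using False assms by auto
  ultimately show ?thesis using False sum_delta_pair[of "i - 1" s p np f] assms by simp
qed

lemma mult_mat_vec_index_sum:
  assumes "A \<in> carrier_mat np nt" "v \<in> carrier_vec nt" "p < np"
  shows "(A *\<^sub>v v) $ p = (\<Sum>t<nt. A $$ (p, t) * (v $ t :: real))"
  using assms by (simp add: scalar_prod_def atLeast0LessThan)

theorem msp_feasible_iff_lp_feasible:
  assumes "Pre \<in> carrier_mat np nt" "Post \<in> carrier_mat np nt"
    and "m0 \<in> carrier_vec np" "mf \<in> carrier_vec np" "s \<ge> 1"
    and m: "\<And>i. i \<in> {1..s} \<Longrightarrow> m i \<in> carrier_vec np"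
    and \<sigma>: "\<And>i. i \<in> {1..s} \<Longrightarrow> \<sigma> i \<in> carrier_vec nt"
    and m0: "m 0 = map_vec real m0"
  shows "msp_feasible Pre Post m0 mf s m \<sigma> \<longleftrightarrow>
    lp_feasible (msp_lp Pre Post m0 mf s) (stack np nt s m \<sigma>)"
proof -
  define C where "C = incidence Pre Post"
  have C: "C \<in> carrier_mat np nt" using assms unfolding C_def incidence_def by (intro minus_carrier_mat)
  have dims: "dim_row Pre = np" "dim_col Pre = nt" "dim_row Post = np" using assms by auto
  define L where "L r = (\<Sum>i=1..s. \<Sum>p<np. coeff_of Pre Post s r (MVar i p) * m i $ p) +
        (\<Sum>i=1..s. \<Sum>t<nt. coeff_of Pre Post s r (SVar i t) * \<sigma> i $ t)" for r
  have prev: "(if i = 1 then real (m0 $ p) else 0) + (if i = 1 then 0 else m (i - 1) $ p) =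
      m (i - 1) $ p" if "p < np" for i p
    using that m0 assms(3) by auto
  have flow: "L (Flow i p) = m i $ p - (if i = 1 then 0 else m (i - 1) $ p) - (C *\<^sub>v \<sigma> i) $ p"
    if "i \<in> {1..s}" "p < np" for i p
  proof -
    have "coeff_of Pre Post s (Flow i p) (MVar j q) =
      (if q = p \<and> j = i then 1 else 0) - (if q = p \<and> Suc j = i then 1 else 0)" for j q
      by simp
    then have 1: "(\<Sum>j=1..s. \<Sum>q<np. coeff_of Pre Post s (Flow i p) (MVar j q) * m j $ q) =
       m i $ p - (if i = 1 then 0 else m (i - 1) $ p)"
      using sum_delta_pair[OF that, of "\<lambda>j q. m j $ q"] sum_delta_prev[OF that, of "\<lambda>j q. m j $ q"]
      by (simp only: left_diff_distrib sum_subtractf)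
    show ?thesis
      using sum_delta_stage[OF that(1), where c = "\<lambda>t. - (C $$ (p, t))" and f = "\<lambda>j t. \<sigma> j $ t" and nt = nt]
        mult_mat_vec_index_sum[OF C \<sigma>[OF that(1)] that(2)]
      unfolding L_def 1 unfolding coeff_of.simps C_def[symmetric] by (simp add: sum_negf)
  qed
  have cap: "L (Capacity i p) = (if i = 1 then 0 else m (i - 1) $ p) + (Post *\<^sub>v \<sigma> i) $ p"
    if "i \<in> {1..s}" "p < np" for i p
    using sum_delta_stage[OF that(1), where c = "\<lambda>t. Post $$ (p, t)" and f = "\<lambda>j t. \<sigma> j $ t" and nt = nt]
      mult_mat_vec_index_sum[OF assms(2) \<sigma>[OF that(1)] that(2)]
      sum_delta_prev[OF that, of "\<lambda>j q. m j $ q"]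
    unfolding L_def by simp
  have fin: "L (Final p) = m s $ p" if "p < np" for p
    using sum_delta_pair[of s s p np "\<lambda>j q. m j $ q"] that assms(5)
    unfolding L_def by simp
  have mn: "L (MNonneg i p) = m i $ p" if "i \<in> {1..s}" "p < np" for i p
    using sum_delta_pair[OF that, of "\<lambda>j q. m j $ q"] unfolding L_def by simp
  have sn: "L (SNonneg i p) = \<sigma> i $ p" if "i \<in> {1..s}" "p < nt" for i p
    using sum_delta_pair[OF that, of "\<lambda>j q. \<sigma> j $ q"] unfolding L_def by simp
  have mprev: "m (i - 1) \<in> carrier_vec np" if "i \<in> {1..s}" for i
    using that m[of "i - 1"] m0 assms(3) by (cases "i = 1") (auto simp: le_diff_conv2)
  have "lp_feasible (msp_lp Pre Post m0 mf s) (stack np nt s m \<sigma>) \<longleftrightarrow>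
    (\<forall>r\<in>set (msp_rows np nt s). holds (rel_of r) (L r) (rhs_of m0 mf r))"
    unfolding L_def by (rule msp_lp_feasible_iff) (use dims in auto)
  also have "\<dots> \<longleftrightarrow>
    (\<forall>i\<in>{1..s}. \<forall>p<np. holds Eq (L (Flow i p)) (rhs_of m0 mf (Flow i p))) \<and>
    (\<forall>i\<in>{1..s}. \<forall>p<np. holds Le (L (Capacity i p)) (rhs_of m0 mf (Capacity i p))) \<and>
    (\<forall>p<np. holds Eq (L (Final p)) (real (mf $ p))) \<and>
    (\<forall>i\<in>{1..s}. (\<forall>p<np. holds Ge (L (MNonneg i p)) 0) \<and> (\<forall>t<nt. holds Ge (L (SNonneg i t)) 0))"
    unfolding ball_msp_rows by simp
  also have "(\<forall>i\<in>{1..s}. \<forall>p<np. holds Eq (L (Flow i p)) (rhs_of m0 mf (Flow i p))) \<longleftrightarrow>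
    (\<forall>i\<in>{1..s}. m i = m (i - 1) + C *\<^sub>v \<sigma> i)"
  proof (rule ball_cong[OF refl])
    fix i assume i: "i \<in> {1..s}"
    have "(m i = m (i - 1) + C *\<^sub>v \<sigma> i) \<longleftrightarrow>
      (\<forall>p<np. m i $ p = m (i - 1) $ p + (C *\<^sub>v \<sigma> i) $ p)"
      using m[OF i] mprev[OF i] C by (auto simp: vec_eq_iff)
    also have "\<dots> \<longleftrightarrow> (\<forall>p<np. holds Eq (L (Flow i p)) (rhs_of m0 mf (Flow i p)))"
      using prev[of _ i] flow[OF i] by (intro all_cong) (smt (verit) holds.simps(1) rhs_of.simps(1))
    finally show "(\<forall>p<np. holds Eq (L (Flow i p)) (rhs_of m0 mf (Flow i p))) \<longleftrightarrow>
      m i = m (i - 1) + C *\<^sub>v \<sigma> i" ..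
  qed
  also have "(\<forall>i\<in>{1..s}. \<forall>p<np. holds Le (L (Capacity i p)) (rhs_of m0 mf (Capacity i p))) \<longleftrightarrow>
    (\<forall>i\<in>{1..s}. Post *\<^sub>v \<sigma> i + m (i - 1) \<le> ones np)"
  proof (rule ball_cong[OF refl])
    fix i assume i: "i \<in> {1..s}"
    have "(Post *\<^sub>v \<sigma> i + m (i - 1) \<le> ones np) \<longleftrightarrow>
      (\<forall>p<np. (Post *\<^sub>v \<sigma> i) $ p + m (i - 1) $ p \<le> 1)"
      using mprev[OF i] assms(2) by (auto simp: less_eq_vec_def ones_def)
    also have "\<dots> \<longleftrightarrow> (\<forall>p<np. holds Le (L (Capacity i p)) (rhs_of m0 mf (Capacity i p)))"
      using prev[of _ i] cap[OF i] by (intro all_cong) (smt (verit) holds.simps(2) rhs_of.simps(2))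
    finally show "(\<forall>p<np. holds Le (L (Capacity i p)) (rhs_of m0 mf (Capacity i p))) \<longleftrightarrow>
      Post *\<^sub>v \<sigma> i + m (i - 1) \<le> ones np" ..
  qed
  also have "(\<forall>p<np. holds Eq (L (Final p)) (real (mf $ p))) \<longleftrightarrow> m s = map_vec real mf"
    using m[of s] assms(4,5) fin by (auto simp: vec_eq_iff)
  also have "(\<forall>i\<in>{1..s}. (\<forall>p<np. holds Ge (L (MNonneg i p)) 0) \<and> (\<forall>t<nt. holds Ge (L (SNonneg i t)) 0))
     \<longleftrightarrow> (\<forall>i\<in>{1..s}. 0\<^sub>v np \<le> m i \<and> 0\<^sub>v nt \<le> \<sigma> i)"
  proof (rule ball_cong[OF refl])
    fix i assume i: "i \<in> {1..s}"
    have "dim_vec (m i) = np" "dim_vec (\<sigma> i) = nt" using m[OF i] \<sigma>[OF i] by auto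
    then show "((\<forall>p<np. holds Ge (L (MNonneg i p)) 0) \<and> (\<forall>t<nt. holds Ge (L (SNonneg i t)) 0)) \<longleftrightarrow>
      0\<^sub>v np \<le> m i \<and> 0\<^sub>v nt \<le> \<sigma> i"
      using mn[OF i] sn[OF i] by (simp add: less_eq_vec_def)
  qed
  finally show ?thesis
    unfolding msp_feasible_def dims C_def by (simp only: m0 simp_thms)
qed

theorem msp_objective_eq_cost:
  assumes "Pre \<in> carrier_mat np nt" and \<sigma>: "\<And>i. i \<in> {1..s} \<Longrightarrow> \<sigma> i \<in> carrier_vec nt"
  shows "msp_objective Pre s \<sigma> = cost_vector (msp_lp Pre Post m0 mf s) \<bullet> stack np nt s m \<sigma>"
proof -
  have "ones nt \<bullet> \<sigma> i = (\<Sum>t<nt. \<sigma> i $ t)" if "i \<in> {1..s}" for i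
    using \<sigma>[OF that] by (simp add: ones_def scalar_prod_def atLeast0LessThan)
  then show ?thesis using assms(1)
    by (simp add: msp_objective_def msp_lp_def Let_def stack_def scalar_prod_lists
      sum_list_variables sum_distrib_right mult.commute del: vec_of_list_map)
qed

end

theory Submission
  imports Defs
begin

section \<open>Determinants of network matrices with additional sparse rows\<close>

text \<open>Zero rows count as sparse, so that the property survives the deletion of
  columns.\<close>

definition sparse_row :: "'a :: zero mat \<Rightarrow> nat \<Rightarrow> bool" where
  "sparse_row A i \<longleftrightarrow> (\<forall>j<dim_col A. \<forall>j'<dim_col A. A $$ (i, j) \<noteq> 0 \<longrightarrow> A $$ (i, j') \<noteq> 0 \<longrightarrow> j = j')"

text \<open>Serves Laplace expansion, with \<open>a\<close> the entries of a row or column and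
  \<open>b\<close> their cofactors: at most one product survives, and signs are closed under
  multiplication.\<close>

lemma sum_sparse_signs:
  fixes a b :: "nat \<Rightarrow> 'a :: idom"
  assumes sparse: "\<And>k k'. k < n \<Longrightarrow> k' < n \<Longrightarrow> a k \<noteq> 0 \<Longrightarrow> a k' \<noteq> 0 \<Longrightarrow> k = k'"
    and "\<And>k. k < n \<Longrightarrow> a k \<in> {- 1, 0, 1}" and "\<And>k. k < n \<Longrightarrow> b k \<in> {- 1, 0, 1}"
  shows "(\<Sum>k<n. a k * b k) \<in> {- 1, 0, 1}"
proof (cases "\<exists>k<n. a k \<noteq> 0")
  case True
  then obtain k where k: "k < n" "a k \<noteq> 0" by auto
  have "(\<Sum>l<n. a l * b l) = (\<Sum>l\<in>{k}. a l * b l)"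
    by (rule sum.mono_neutral_right) (use k sparse in auto)
  then show ?thesis using assms(2,3)[OF k(1)] by auto
next
  case False
  then have "(\<Sum>k<n. a k * b k) = 0" by (intro sum.neutral) auto
  then show ?thesis by simp
qed

lemma cofactor_sign:
  assumes "det (mat_delete A i j) \<in> {- 1, 0, 1}"
  shows "cofactor A i j \<in> {- 1, 0, 1}"
  using assms unfolding cofactor_def by (cases "even (i + j)") auto

text \<open>The all-ones vector lies in the kernel of the transpose, and \<open>n > 0\<close> makes
  it nonzero.\<close>

lemma det_zero_if_column_sums_zero:
  fixes A :: "'a :: idom mat"
  assumes A: "A \<in> carrier_mat n n" and "n > 0"
    and sums: "\<And>j. j < n \<Longrightarrow> (\<Sum>i<n. A $$ (i, j)) = 0"
  shows "det A = 0"
proof -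
  let ?v = "vec n (\<lambda>_. 1 :: 'a)"
  have "?v $ 0 \<noteq> 0\<^sub>v n $ 0" using \<open>n > 0\<close> by simp
  then have "?v \<noteq> 0\<^sub>v n" by metis
  moreover have "transpose_mat A *\<^sub>v ?v = 0\<^sub>v n"
    using A sums by (intro eq_vecI) (auto simp: scalar_prod_def atLeast0LessThan)
  ultimately have "det (transpose_mat A) = 0"
    using det_0_iff_vec_prod_zero[of "transpose_mat A" n] A by (metis transpose_carrier_mat vec_carrier)
  then show ?thesis using det_transpose[OF A] by simp
qed

text \<open>Apart from its sparse rows, such a matrix is a submatrix of the node-arc incidence matrix of a
  directed graph. A sparse row or a column with at most one nonzero entry is removed by Laplace
  expansion; when there is none left, every column holds one \<open>1\<close> and one \<open>- 1\<close>, so the rows are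
  linearly dependent.\<close>

lemma det_network_matrix:
  fixes A :: "'a :: idom mat"
  assumes "A \<in> carrier_mat n n"
    and "\<And>i j. i < n \<Longrightarrow> j < n \<Longrightarrow> A $$ (i, j) \<in> {- 1, 0, 1}"
    and "\<And>i i' j. i < n \<Longrightarrow> i' < n \<Longrightarrow> j < n \<Longrightarrow> A $$ (i, j) = A $$ (i', j) \<Longrightarrow> A $$ (i, j) \<noteq> 0 \<Longrightarrow>
      \<not> sparse_row A i \<Longrightarrow> \<not> sparse_row A i' \<Longrightarrow> i = i'"
  shows "det A \<in> {- 1, 0, 1}"
  using assms
proof (induction n arbitrary: A)
  case 0
  then show ?case by simp
next
  case (Suc n)
  note A = Suc.prems(1)
  have minor: "cofactor A k l \<in> {- 1, 0, 1}" if kl: "k < Suc n" "l < Suc n" for k l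
  proof (rule cofactor_sign, rule Suc.IH)
    let ?B = "mat_delete A k l"
    have lt: "insert_index m i < Suc n" if "i < n" for m i
      using that unfolding insert_index_def by auto
    have inj: "i = i'" if "insert_index m i = insert_index m i'" for m i i'
      using that unfolding insert_index_def by (auto split: if_splits)
    show B: "?B \<in> carrier_mat n n" using A unfolding mat_delete_def by auto
    note entry = mat_delete_index[OF A kl, symmetric]
    show "?B $$ (i, j) \<in> {- 1, 0, 1}" if "i < n" "j < n" for i j
      unfolding entry[OF that] using Suc.prems(2) lt that by blast
    \<comment> \<open>By contraposition, a row that is not sparse in the minor comes from one that
      is not sparse in \<open>A\<close>, so the uniqueness hypothesis passes to the minor.\<close>
    have sparse: "sparse_row ?B i" if "sparse_row A (insert_index k i)" "i < n" for i
      using that A B lt inj unfolding sparse_row_def by (metis carrier_matD(2) entry)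
    show "i = i'" if "i < n" "i' < n" "j < n" "?B $$ (i, j) = ?B $$ (i', j)" "?B $$ (i, j) \<noteq> 0"
      "\<not> sparse_row ?B i" "\<not> sparse_row ?B i'" for i i' j
      using that sparse Suc.prems(3)[OF lt lt lt] inj by (metis entry)
  qed
  consider (row) k where "k < Suc n" "sparse_row A k"
    | (col) l where "l < Suc n"
        "\<And>i i'. i < Suc n \<Longrightarrow> i' < Suc n \<Longrightarrow> A $$ (i, l) \<noteq> 0 \<Longrightarrow> A $$ (i', l) \<noteq> 0 \<Longrightarrow> i = i'"
    | (dense) "\<And>k. k < Suc n \<Longrightarrow> \<not> sparse_row A k"
        "\<And>l. l < Suc n \<Longrightarrow> \<exists>i<Suc n. \<exists>i'<Suc n. A $$ (i, l) \<noteq> 0 \<and> A $$ (i', l) \<noteq> 0 \<and> i \<noteq> i'"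
    by metis
  then show ?case
  proof cases
    case row
    show ?thesis
      unfolding laplace_expansion_row[OF A row(1)]
      by (rule sum_sparse_signs) (use row A minor Suc.prems(2) in \<open>auto simp: sparse_row_def\<close>)
  next
    case col
    show ?thesis
      unfolding laplace_expansion_column[OF A col(1)]
      by (rule sum_sparse_signs) (use col minor Suc.prems(2) in auto)
  next
    case dense
    have "(\<Sum>i<Suc n. A $$ (i, j)) = 0" if j: "j < Suc n" for j
    proof -
      obtain i i' where i: "i < Suc n" "i' < Suc n" "A $$ (i, j) \<noteq> 0" "A $$ (i', j) \<noteq> 0" "i \<noteq> i'"
        using dense(2)[OF j] by blast
      have eq: "a = b" if "a < Suc n" "b < Suc n" "A $$ (a, j) = A $$ (b, j)" "A $$ (a, j) \<noteq> 0" for a b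
        using Suc.prems(3) that j dense(1) by blast
      have ne: "A $$ (i, j) \<noteq> A $$ (i', j)" using eq i by blast
      have opp: "A $$ (i, j) + A $$ (i', j) = 0"
        using Suc.prems(2)[OF i(1) j] Suc.prems(2)[OF i(2) j] i ne by auto
      \<comment> \<open>Rows \<open>i\<close> and \<open>i'\<close> already use up the values
        \<open>1\<close> and \<open>- 1\<close>; a third nonzero entry would repeat one of them,
        against \<open>eq\<close>.\<close>
      have "A $$ (a, j) = 0" if "a < Suc n" "a \<noteq> i" "a \<noteq> i'" for a
        using Suc.prems(2)[OF i(1) j] Suc.prems(2)[OF i(2) j] Suc.prems(2)[OF that(1) j] i ne
          eq[OF that(1) i(1)] eq[OF that(1) i(2)] that by auto
      then have "(\<Sum>a<Suc n. A $$ (a, j)) = (\<Sum>a\<in>{i, i'}. A $$ (a, j))"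
        by (intro sum.mono_neutral_right) (use i in auto)
      then show ?thesis using i opp by simp
    qed
    then show ?thesis using det_zero_if_column_sums_zero[OF A] by simp
  qed
qed

section \<open>Operations on several rows at once\<close>

text \<open>The rows are treated one at a time. Since \<open>f\<close> maps \<open>S\<close> outside
  \<open>S\<close>, the row being added is always still the original row of \<open>A\<close>, so
  each step is an elementary row addition.\<close>

lemma det_add_rows:
  fixes A :: "'a :: comm_ring_1 mat"
  assumes A: "A \<in> carrier_mat n n" and "finite S" and "S \<subseteq> {..<n}" and "f ` S \<subseteq> {..<n} - S"
  shows "det (mat n n (\<lambda>(i, j). A $$ (i, j) + (if i \<in> S then A $$ (f i, j) else 0))) = det A"
proof -
  have "det (mat n n (\<lambda>(i, j). A $$ (i, j) + (if i \<in> T then A $$ (f i, j) else 0))) = det A"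
    if "finite T" "T \<subseteq> S" for T
    using that
  proof (induction T rule: finite_induct)
    case empty
    have "mat n n (\<lambda>(i, j). A $$ (i, j) + (if i \<in> {} then A $$ (f i, j) else 0)) = A"
      using A by (intro eq_matI) auto
    then show ?case by simp
  next
    case (insert k T)
    let ?B = "\<lambda>T. mat n n (\<lambda>(i, j). A $$ (i, j) + (if i \<in> T then A $$ (f i, j) else 0))"
    have k: "k < n" "f k < n" "f k \<notin> T" "k \<noteq> f k" using insert assms by auto
    then have "?B (insert k T) = addrow 1 k (f k) (?B T)"
      using insert by (intro eq_matI) auto
    moreover have "det (addrow 1 k (f k) (?B T)) = det (?B T)"
      by (rule det_addrow[OF k(2) k(4)]) simp
    ultimately show ?case using insert by simp
  qed
  then show ?thesis using \<open>finite S\<close> by blast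
qed

text \<open>Each negation flips the sign. The determinant up to sign suffices later, because
  \<open>{- 1, 0, 1}\<close> is closed under negation.\<close>

lemma det_negate_rows:
  fixes A :: "'a :: comm_ring_1 mat"
  assumes A: "A \<in> carrier_mat n n" and "finite K" and "K \<subseteq> {..<n}"
  shows "det (mat n n (\<lambda>(i, j). if i \<in> K then - A $$ (i, j) else A $$ (i, j))) \<in> {det A, - det A}"
  using assms(2,3)
proof (induction K rule: finite_induct)
  case empty
  have "mat n n (\<lambda>(i, j). if i \<in> {} then - A $$ (i, j) else A $$ (i, j)) = A"
    using A by (intro eq_matI) auto
  then show ?case by simp
next
  case (insert k K)
  let ?B = "\<lambda>K. mat n n (\<lambda>(i, j). if i \<in> K then - A $$ (i, j) else A $$ (i, j))"
  have "?B (insert k K) = multrow k (- 1) (?B K)"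
    using insert by (intro eq_matI) auto
  moreover have "det (multrow k (- 1) (?B K)) = - 1 * det (?B K)"
    by (rule det_multrow) (use insert in auto)
  ultimately show ?case using insert by auto
qed

section \<open>Coefficients of the transformed constraints\<close>

text \<open>When both constraints of place \<open>p\<close> and stage \<open>i\<close> are selected, adding the capacity row to the
  flow row turns the latter into \<open>m i $ p + (Pre *\<^sub>v \<sigma> i) $ p\<close>. With the capacity rows negated,
  every variable then occurs at most once with coefficient \<open>1\<close> and at most once with coefficient
  \<open>- 1\<close> in the flow and capacity rows.\<close>

fun network_coeff :: "real mat \<Rightarrow> real mat \<Rightarrow> nat \<Rightarrow> constr set \<Rightarrow> constr \<Rightarrow> variable \<Rightarrow> real" where
  "network_coeff Pre Post s R (Flow i p) v = coeff_of Pre Post s (Flow i p) v +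
     (if Capacity i p \<in> R then coeff_of Pre Post s (Capacity i p) v else 0)"
| "network_coeff Pre Post s R (Capacity i p) v = - coeff_of Pre Post s (Capacity i p) v"
| "network_coeff Pre Post s R r v = coeff_of Pre Post s r v"

text \<open>Singles out the constraints that involve one variable only. The final-marking equations
  are among them, besides the nonnegativity constraints.\<close>

fun bound_row :: "constr \<Rightarrow> bool" where
  "bound_row (Flow i p) = False"
| "bound_row (Capacity i p) = False"
| "bound_row _ = True"

text \<open>The bounds here and in \<open>valid_variable\<close> keep every access to
  \<open>Pre\<close> and \<open>Post\<close> inside the matrices; the remaining coefficients only
  compare indices.\<close>

fun valid_row :: "nat \<Rightarrow> constr \<Rightarrow> bool" where
  "valid_row np (Flow i p) = (p < np)"
| "valid_row np (Capacity i p) = (p < np)"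
| "valid_row np _ = True"

fun valid_variable :: "nat \<Rightarrow> variable \<Rightarrow> bool" where
  "valid_variable nt (MVar i p) = True"
| "valid_variable nt (SVar i t) = (t < nt)"

lemma bound_row_coeff:
  assumes "bound_row r" "network_coeff Pre Post s R r v \<noteq> 0" "network_coeff Pre Post s R r w \<noteq> 0"
  shows "v = w"
  using assms by (cases r; cases v; cases w) (auto split: if_splits)

lemma state_machine_entries:
  assumes "state_machine np nt Pre Post" "p < np" "t < nt"
  shows "Pre $$ (p, t) = 0 \<or> Pre $$ (p, t) = 1" "Post $$ (p, t) = 0 \<or> Post $$ (p, t) = 1"
    "incidence Pre Post $$ (p, t) = Post $$ (p, t) - Pre $$ (p, t)"
proof -
  have dims: "Pre \<in> carrier_mat np nt" "Post \<in> carrier_mat np nt"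
    and sub: "elements_mat Pre \<subseteq> {0, 1}" "elements_mat Post \<subseteq> {0, 1}"
    using assms(1) unfolding state_machine_def petri_net_def by auto
  have "Pre $$ (p, t) \<in> elements_mat Pre" "Post $$ (p, t) \<in> elements_mat Post"
    using dims assms(2,3) by (auto intro: elements_matI)
  then show "Pre $$ (p, t) = 0 \<or> Pre $$ (p, t) = 1" "Post $$ (p, t) = 0 \<or> Post $$ (p, t) = 1"
    using sub by auto
  show "incidence Pre Post $$ (p, t) = Post $$ (p, t) - Pre $$ (p, t)"
    using dims assms(2,3) unfolding incidence_def by simp
qed

text \<open>On the firing variables of its own stage, a flow row carries \<open>Pre\<close> if its
  capacity row was added and \<open>Pre - Post\<close> otherwise; a capacity row carries
  \<open>- Post\<close>.\<close>

lemma network_coeff_sign: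
  assumes sm: "state_machine np nt Pre Post" and "valid_row np r" "valid_variable nt v"
  shows "network_coeff Pre Post s R r v \<in> {- 1, 0, 1}"
proof (cases v)
  case (MVar j q)
  then show ?thesis by (cases r) auto
next
  case (SVar j t)
  then have "t < nt" using assms(3) by simp
  note entries = state_machine_entries[OF sm _ this]
  show ?thesis
  proof (cases r)
    case (Flow i p)
    then show ?thesis using SVar assms(2) entries[of p] by auto
  next
    case (Capacity i p)
    then show ?thesis using SVar assms(2) entries[of p] by auto
  qed (use SVar in auto)
qed

text \<open>For a firing variable, \<open>1\<close> can occur only in the flow row of the unique
  input place. The value \<open>- 1\<close> can occur only at the unique output place: in the
  capacity row if that row lies in \<open>R\<close>, since the addition then removed it from the
  flow row, and in the flow row otherwise.\<close>

lemma network_coeff_unique: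
  assumes sm: "state_machine np nt Pre Post"
    and "valid_row np r" "valid_row np r'" "valid_variable nt v" "r \<in> R" "r' \<in> R"
    and "\<not> bound_row r" "\<not> bound_row r'"
    and "network_coeff Pre Post s R r v = network_coeff Pre Post s R r' v"
    and "network_coeff Pre Post s R r v \<noteq> 0"
  shows "r = r'"
proof -
  have u: "p = q" if "p < np" "q < np" "t < nt"
    "Pre $$ (p, t) = 1 \<and> Pre $$ (q, t) = 1 \<or> Post $$ (p, t) = 1 \<and> Post $$ (q, t) = 1" for p q t
    using sm that unfolding state_machine_def by blast
  note e = state_machine_entries[OF sm]
  show ?thesis
  proof (cases v)
    case (MVar j q)
    \<comment> \<open>The coefficient \<open>1\<close> sits in \<open>Flow j q\<close>. The
      coefficient \<open>- 1\<close> of \<open>Flow (Suc j) q\<close> is cancelled exactly when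
      \<open>Capacity (Suc j) q\<close>, which also carries \<open>- 1\<close>, lies in
      \<open>R\<close>.\<close>
    then show ?thesis using assms(2-) by (cases r; cases r') (auto split: if_splits)
  next
    case (SVar j t)
    then have t: "t < nt" using assms by simp
    show ?thesis
    proof (cases r; cases r'; (use assms in \<open>simp; fail\<close>)?)
      fix i p i' p' assume r: "r = Flow i p" "r' = Flow i' p'"
      then show ?thesis using assms(2-) SVar t e[of p t] e[of p' t] u[of p p' t]
        by (auto split: if_splits)
    next
      fix i p i' p' assume r: "r = Flow i p" "r' = Capacity i' p'"
      then show ?thesis using assms(2-) SVar t e[of p t] e[of p' t] u[of p p' t]
        by (auto split: if_splits)
    next
      fix i p i' p' assume r: "r = Capacity i p" "r' = Flow i' p'"
      then show ?thesis using assms(2-) SVar t e[of p t] e[of p' t] u[of p p' t]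
        by (auto split: if_splits)
    next
      fix i p i' p' assume r: "r = Capacity i p" "r' = Capacity i' p'"
      then show ?thesis using assms(2-) SVar t e[of p t] e[of p' t] u[of p p' t]
        by (auto split: if_splits)
    qed
  qed
qed

section \<open>Minors of the constraint matrix\<close>

text \<open>The row operations take place inside the minor \<open>A\<close>: additions give
  \<open>B\<close>, negations give \<open>C\<close>. The determinant changes at most in sign, and
  \<open>C\<close> has the network form.\<close>

lemma det_constraint_minor:
  assumes sm: "state_machine np nt Pre Post"
    and r: "inj_on r {..<n}" "\<And>i. i < n \<Longrightarrow> valid_row np (r i)"
    and c: "inj_on c {..<n}" "\<And>j. j < n \<Longrightarrow> valid_variable nt (c j)"
  shows "det (mat n n (\<lambda>(i, j). coeff_of Pre Post s (r i) (c j))) \<in> {- 1, 0, 1}"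
proof -
  define R where "R = r ` {..<n}"
  define A where "A = mat n n (\<lambda>(i, j). coeff_of Pre Post s (r i) (c j))"
  define S where "S = {i. i < n \<and> (\<exists>k p. r i = Flow k p \<and> Capacity k p \<in> R)}"
  define K where "K = {i. i < n \<and> (\<exists>k p. r i = Capacity k p)}"
  \<comment> \<open>Sends a flow row to the position of its capacity row. The value is meaningful
    only on \<open>S\<close>, where that capacity row is selected.\<close>
  define f where "f i = (case r i of Flow k p \<Rightarrow> the_inv_into {..<n} r (Capacity k p) | _ \<Rightarrow> i)" for i
  define B where "B = mat n n (\<lambda>(i, j). A $$ (i, j) + (if i \<in> S then A $$ (f i, j) else 0))"
  define C where "C = mat n n (\<lambda>(i, j). if i \<in> K then - B $$ (i, j) else B $$ (i, j))"
  have f: "f i < n" "r (f i) = Capacity k p" if "i < n" "r i = Flow k p" "Capacity k p \<in> R" for i k p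
    using the_inv_into_into[OF r(1), of "Capacity k p"] f_the_inv_into_f[OF r(1), of "Capacity k p"] that
    unfolding f_def R_def by auto
  \<comment> \<open>\<open>S\<close> holds positions of flow rows and \<open>f\<close> leads to
    capacity rows, so no added row is itself modified.\<close>
  have "f ` S \<subseteq> {..<n} - S"
  proof clarify
    fix i assume "i \<in> S"
    then obtain k p where "i < n" "r i = Flow k p" "Capacity k p \<in> R" unfolding S_def by auto
    from f[OF this] show "f i \<in> {..<n} - S" unfolding S_def by simp
  qed
  then have "det B = det A"
    unfolding B_def by (intro det_add_rows) (auto simp: A_def S_def)
  moreover have "det C \<in> {det B, - det B}"
    unfolding C_def by (rule det_negate_rows) (auto simp: B_def K_def)
  moreover have "det C \<in> {- 1, 0, 1}"
  proof (rule det_network_matrix)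
    show car: "C \<in> carrier_mat n n" unfolding C_def by simp
    have C: "C $$ (i, j) = network_coeff Pre Post s R (r i) (c j)" if "i < n" "j < n" for i j
    proof (cases "r i")
      case (Flow k p)
      then show ?thesis using that f[OF that(1) Flow] unfolding C_def B_def A_def S_def K_def by auto
    qed (use that in \<open>auto simp: C_def B_def A_def S_def K_def\<close>)
    show "C $$ (i, j) \<in> {- 1, 0, 1}" if "i < n" "j < n" for i j
      unfolding C[OF that] using network_coeff_sign[OF sm] r c that by blast
    \<comment> \<open>Nonzero entries of a bound row belong to one variable, and injectivity of
      \<open>c\<close> gives one column. Rows of \<open>C\<close> that are not sparse are thus flow
      or capacity rows.\<close>
    have sparse: "sparse_row C i" if "i < n" "bound_row (r i)" for i
      unfolding sparse_row_def
      using C that car bound_row_coeff[OF that(2)] c(1) by (metis carrier_matD(2) inj_onD lessThan_iff)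
    show "i = i'" if "i < n" "i' < n" "j < n" "C $$ (i, j) = C $$ (i', j)" "C $$ (i, j) \<noteq> 0"
      "\<not> sparse_row C i" "\<not> sparse_row C i'" for i i' j
    proof -
      have "r i = r i'"
        by (rule network_coeff_unique[OF sm, of _ _ "c j" R s])
          (use that C sparse r(2) c(2) in \<open>auto simp: R_def\<close>)
      then show ?thesis using r(1) that by (auto dest: inj_onD)
    qed
  qed
  ultimately show ?thesis unfolding A_def by auto
qed

section \<open>From index sets to distinct rows and columns\<close>

text \<open>The nested list is the image of \<open>List.product xs ys\<close> under an injective
  map.\<close>

lemma distinct_concat_map:
  assumes "\<And>i i' j j'. g i j = g i' j' \<Longrightarrow> i = i' \<and> j = j'" "distinct xs" "distinct ys"
  shows "distinct (concat (map (\<lambda>i. map (g i) ys) xs))"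
proof -
  have "concat (map (\<lambda>i. map (g i) ys) xs) = map (\<lambda>(i, j). g i j) (List.product xs ys)"
    by (induction xs) (auto simp: comp_def)
  then show ?thesis
    using assms by (auto simp: distinct_map distinct_product inj_on_def)
qed

lemma distinct_msp_variables: "distinct (msp_variables np nt s)"
  unfolding msp_variables_def distinct_append by (auto intro!: distinct_concat_map simp del: upt_Suc)

lemma distinct_msp_rows: "distinct (msp_rows np nt s)"
  unfolding msp_rows_def distinct_append
  by (auto intro!: distinct_concat_map simp: distinct_map inj_on_def simp del: upt_Suc)

lemma valid_msp_rows: "r \<in> set (msp_rows np nt s) \<Longrightarrow> valid_row np r"
  unfolding msp_rows_def by auto

lemma valid_msp_variables: "v \<in> set (msp_variables np nt s) \<Longrightarrow> valid_variable nt v"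
  unfolding msp_variables_def by auto

text \<open>\<open>pick I\<close> enumerates \<open>I\<close> in strictly increasing order, at all
  positions if \<open>I\<close> is infinite and below \<open>card I\<close> otherwise.\<close>

lemma inj_on_pick: "inj_on (pick I) {..<card {i. i < m \<and> i \<in> I}}"
proof (rule linorder_inj_onI)
  fix x y assume "x < y" "y \<in> {..<card {i. i < m \<and> i \<in> I}}"
  moreover from this have "infinite I \<or> y < card I"
    using card_mono[of I "{i. i < m \<and> i \<in> I}"] by fastforce
  ultimately show "pick I x \<noteq> pick I y"
    using pick_mono[of y I x] pick_mono_inf[of I x y] by fastforce
qed auto

theorem theorem4:
  fixes np nt s :: nat and Pre Post :: "real mat" and m0 mf :: "nat vec"
  assumes "state_machine np nt Pre Post"
    and "m0 \<in> carrier_vec np" and "mf \<in> carrier_vec np"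
    and "s \<ge> 1"
  shows "totally_unimodular (constraint_matrix (msp_lp Pre Post m0 mf s))"
  unfolding totally_unimodular_def
proof (intro allI impI)
  fix I J
  define rs where "rs = msp_rows np nt s"
  define vs where "vs = msp_variables np nt s"
  define M where "M = constraint_matrix (msp_lp Pre Post m0 mf s)"
  have "Pre \<in> carrier_mat np nt" using assms(1) unfolding state_machine_def petri_net_def by simp
  then have M: "M = mat (length rs) (length vs) (\<lambda>(r, c). coeff_of Pre Post s (rs ! r) (vs ! c))"
    unfolding M_def msp_lp_def rs_def vs_def by (simp add: Let_def)
  \<comment> \<open>\<open>I\<close> may contain indices beyond the matrix, even infinitely many;
    \<open>submatrix\<close> keeps only those below the dimension, and these are counted.\<close>
  define n where "n = card {i. i < length rs \<and> i \<in> I}"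
  assume "square_mat (submatrix (constraint_matrix (msp_lp Pre Post m0 mf s)) I J)"
  then have n: "card {j. j < length vs \<and> j \<in> J} = n"
    unfolding M_def[symmetric] n_def by (simp add: dim_submatrix M)
  have row: "pick I i < length rs" if "i < n" for i using that pick_le unfolding n_def by blast
  have col: "pick J j < length vs" if "j < n" for j using that pick_le n by blast
  have "submatrix M I J = mat n n (\<lambda>(i, j). coeff_of Pre Post s (rs ! pick I i) (vs ! pick J j))"
    using row col by (intro eq_matI) (auto simp: submatrix_def M n simp flip: n_def)
  moreover have "det (mat n n (\<lambda>(i, j). coeff_of Pre Post s (rs ! pick I i) (vs ! pick J j))) \<in> {- 1, 0, 1}"
  proof (rule det_constraint_minor[OF assms(1)])
    show "inj_on (\<lambda>i. rs ! pick I i) {..<n}"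
      using inj_on_pick[of I "length rs"] row distinct_msp_rows[of np nt s]
      unfolding inj_on_def n_def[symmetric] rs_def[symmetric] by (auto simp: nth_eq_iff_index_eq)
    show "inj_on (\<lambda>j. vs ! pick J j) {..<n}"
      using inj_on_pick[of J "length vs"] col distinct_msp_variables[of np nt s]
      unfolding inj_on_def n vs_def[symmetric] by (auto simp: nth_eq_iff_index_eq)
    show "valid_row np (rs ! pick I i)" if "i < n" for i
      using valid_msp_rows nth_mem[OF row[OF that]] unfolding rs_def by blast
    show "valid_variable nt (vs ! pick J j)" if "j < n" for j
      using valid_msp_variables nth_mem[OF col[OF that]] unfolding vs_def by blast
  qed
  ultimately show "det (submatrix (constraint_matrix (msp_lp Pre Post m0 mf s)) I J) \<in> {- 1, 0, 1}"
    unfolding M_def by simp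
qed

end
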